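(* Let $N\ge2$, $m=N-1$, $0<g_1<\cdots<g_N$. On the whole interlacing root box $\mathcal Z=\prod_{j=1}^m(g_j,g_{j+1})$, the pulled-back mixing entropy $$h_z(z):=\sum_{\ell=1}^Ny_\ell(z)\log y_\ell(z),\qquad y_\ell(z)=\frac{\prod_{j=1}^{m}(g_\ell-z_j)}{\prod_{n\ne\ell}(g_\ell-g_n)},$$ satisfies, for all $j\ne k$ in $\{1,\dots,m\}$, $$(z_k-z_j)\,\partial_{z_jz_k}h_z=\partial_{z_j}h_z-\partial_{z_k}h_z,$$ and its diagonal second derivatives have the explicit positive form $$\partial_{z_jz_j}h_z(z)=\sum_{\ell=1}^N\frac{y_\ell(z)}{(g_\ell-z_j)^2}>0,\qquad j=1,\dots,m.$$ The same differential identities hold after adding an arbitrary constant to $h_z$.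
   Context: For $z\in\mathcal Z$ all $y_\ell(z)$ are strictly positive and $\sum_\ell y_\ell(z)=1$, so $h_z$ is well defined and smooth on $\mathcal Z$. *)

theory Defs
  imports "HOL-Analysis.Analysis"
begin

text \<open>
  A point of real \<open>m\<close>-space, \<open>m = N - 1\<close>, is a function of type \<open>nat \<Rightarrow> real\<close> of which only the
  values at \<open>1, \<dots>, m\<close> matter; the nodes \<open>g\<close> are likewise indexed by \<open>1, \<dots>, N\<close>.
\<close>

definition root_box :: "nat \<Rightarrow> (nat \<Rightarrow> real) \<Rightarrow> (nat \<Rightarrow> real) set" where
  "root_box N g = (\<Pi>\<^sub>E j\<in>{1..N - 1}. {g j<..<g (j + 1)})"

definition root_weight :: "nat \<Rightarrow> (nat \<Rightarrow> real) \<Rightarrow> nat \<Rightarrow> (nat \<Rightarrow> real) \<Rightarrow> real" where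
  "root_weight N g l z =
     (\<Prod>j\<in>{1..N - 1}. g l - z j) / (\<Prod>n\<in>{1..N} - {l}. g l - g n)"

definition mixing_entropy :: "nat \<Rightarrow> (nat \<Rightarrow> real) \<Rightarrow> (nat \<Rightarrow> real) \<Rightarrow> real" where
  "mixing_entropy N g z = (\<Sum>l\<in>{1..N}. root_weight N g l z * ln (root_weight N g l z))"

definition pderiv_at :: "nat \<Rightarrow> ((nat \<Rightarrow> real) \<Rightarrow> real) \<Rightarrow> (nat \<Rightarrow> real) \<Rightarrow> real" where
  "pderiv_at j f z = deriv (\<lambda>t. f (z(j := t))) (z j)"

definition pdifferentiable_at :: "nat \<Rightarrow> ((nat \<Rightarrow> real) \<Rightarrow> real) \<Rightarrow> (nat \<Rightarrow> real) \<Rightarrow> bool" where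
  "pdifferentiable_at j f z \<longleftrightarrow> (\<lambda>t. f (z(j := t))) differentiable (at (z j))"

text \<open>
  Since \<^const>\<open>deriv\<close> is total, the existence of all first and second partial derivatives (pure and
  mixed, in either order) is recorded separately.
\<close>

definition twice_pdifferentiable_on ::
    "nat set \<Rightarrow> ((nat \<Rightarrow> real) \<Rightarrow> real) \<Rightarrow> (nat \<Rightarrow> real) set \<Rightarrow> bool" where
  "twice_pdifferentiable_on I f S \<longleftrightarrow>
     (\<forall>z\<in>S. \<forall>k\<in>I. pdifferentiable_at k f z \<and>
        (\<forall>j\<in>I. pdifferentiable_at j (pderiv_at k f) z))"

end

theory Submission imports Defs
begin

text \<open>
  Since \<open>\<partial>\<^sub>k y\<^sub>l = - y\<^sub>l / (g\<^sub>l - z\<^sub>k)\<close>, one finds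
  \<open>\<partial>\<^sub>k h = - (\<Sum>l. y\<^sub>l / (g\<^sub>l - z\<^sub>k) (ln y\<^sub>l + 1))\<close>. The quotient \<open>y\<^sub>l / (g\<^sub>l - z\<^sub>k)\<close> does
  not depend on \<open>z\<^sub>k\<close>, so only the logarithm contributes to \<open>\<partial>\<^sub>k\<partial>\<^sub>k h\<close>. For \<open>j \<noteq> k\<close> one gets
  \<open>\<partial>\<^sub>j\<partial>\<^sub>k h = (\<Sum>l. y\<^sub>l / ((g\<^sub>l - z\<^sub>j) (g\<^sub>l - z\<^sub>k)) (ln y\<^sub>l + 2))\<close>, and partial fractions give the
  Euler--Poisson--Darboux equation up to the sums \<open>\<Sum>l. y\<^sub>l / (g\<^sub>l - z\<^sub>k)\<close>. These are divided
  differences of order \<open>N - 1\<close> of a polynomial of degree \<open>N - 2\<close>, hence vanish.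
\<close>

text \<open>Lagrange interpolation at \<open>card S\<close> distinct nodes reproduces
  \<open>p\<close>. Each unnormalised basis polynomial \<open>P l\<close> is monic of degree
  \<open>card S - 1\<close>, so the coefficient of \<open>p\<close> there is the sum of the weights
  \<open>c l\<close>.\<close>

lemma divided_difference_eq_coeff:
  fixes p :: "'a::field poly" and g :: "'b \<Rightarrow> 'a"
  assumes S: "finite S" and inj: "inj_on g S" and deg: "degree p < card S"
  shows "(\<Sum>l\<in>S. poly p (g l) / (\<Prod>n\<in>S - {l}. g l - g n)) = coeff p (card S - 1)"
proof -
  define P where "P l = (\<Prod>n\<in>S - {l}. [:- g n, 1:])" for l
  define c where "c l = poly p (g l) / (\<Prod>n\<in>S - {l}. g l - g n)" for l
  define L where "L = (\<Sum>l\<in>S. smult (c l) (P l))"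
  have degP: "degree (P l) = card S - 1" and coeffP: "coeff (P l) (card S - 1) = 1"
    if "l \<in> S" for l
  proof -
    show "degree (P l) = card S - 1"
      using S that by (simp add: P_def degree_prod_sum_eq)
    moreover have "lead_coeff (P l) = 1"
      by (simp add: P_def lead_coeff_prod)
    ultimately show "coeff (P l) (card S - 1) = 1" by simp
  qed
  have "degree L \<le> card S - 1"
    unfolding L_def by (intro degree_sum_le S) (metis degP degree_smult_le)
  have "poly L x = poly p x" if x: "x \<in> g ` S" for x
  proof -
    obtain a where a: "a \<in> S" "x = g a" using x by auto
    have "(\<Prod>n\<in>S - {a}. g a - g n) \<noteq> 0"
      using S inj a by (auto simp: inj_on_def)
    moreover have "poly (P l) (g a) = 0" if "l \<in> S - {a}" for l
      using S a that by (auto simp: P_def poly_prod)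
    moreover have "poly (P a) (g a) = (\<Prod>n\<in>S - {a}. g a - g n)"
      by (simp add: P_def poly_prod)
    ultimately show ?thesis
      using S a by (simp add: L_def poly_sum sum.remove[of S a] c_def)
  qed
  then have "L = p"
  proof (intro poly_eqI_degree[of "g ` S"])
    show "card (g ` S) > degree L" "card (g ` S) > degree p"
      using \<open>degree L \<le> card S - 1\<close> deg by (simp_all add: card_image[OF inj])
  qed auto
  then have "coeff p (card S - 1) = (\<Sum>l\<in>S. c l * coeff (P l) (card S - 1))"
    by (auto simp: L_def coeff_sum)
  then show ?thesis
    by (simp add: coeffP c_def del: One_nat_def cong: sum.cong)
qed

section \<open>The root box and the barycentric weights\<close>

lemma root_box_bounds:
  assumes "z \<in> root_box N g" "k \<in> {1..N - 1}"
  shows "g k < z k" "z k < g (k + 1)"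
  using assms by (auto simp: root_box_def PiE_iff)

lemma root_box_update:
  assumes "z \<in> root_box N g" "k \<in> {1..N - 1}" "g k < t" "t < g (k + 1)"
  shows "z(k := t) \<in> root_box N g"
  using assms by (auto simp: root_box_def PiE_iff extensional_def)

lemma eventually_root_box_update:
  assumes z: "z \<in> root_box N g" and k: "k \<in> {1..N - 1}"
  shows "\<forall>\<^sub>F t in nhds (z k). z(k := t) \<in> root_box N g"
proof -
  have "\<forall>\<^sub>F t in nhds (z k). t \<in> {g k<..<g (k + 1)}"
    using root_box_bounds[OF z k] by (intro eventually_nhds_in_open) auto
  then show ?thesis
    by eventually_elim (use root_box_update[OF z k] in auto)
qed

lemma root_box_separates:
  assumes mono: "strict_mono_on {1..N} g" and z: "z \<in> root_box N g"
    and k: "k \<in> {1..N - 1}" and l: "l \<in> {1..N}"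
  shows "k < l \<Longrightarrow> z k < g l" "l \<le> k \<Longrightarrow> g l < z k" "g l \<noteq> z k"
proof -
  note b = root_box_bounds[OF z k]
  have k': "k \<in> {1..N}" "k + 1 \<in> {1..N}" using k by auto
  have le: "g i \<le> g j" if "i \<in> {1..N}" "j \<in> {1..N}" "i \<le> j" for i j
    using strict_mono_onD[OF mono, of i j] that by (cases "i = j") auto
  show 1: "z k < g l" if "k < l"
    using le[of "k + 1" l] b that k' l by simp
  show 2: "g l < z k" if "l \<le> k"
    using le[of l k] b that k' l by simp
  show "g l \<noteq> z k"
    using 1 2 by (cases "k < l") auto
qed

text \<open>Each factor \<open>g l - z j\<close> is paired with \<open>g l - g (s j)\<close>, where
  \<open>s j\<close> indexes the end of the interval around \<open>z j\<close> that is farther from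
  \<open>g l\<close>. Both factors then lie on the same side of zero, and \<open>s\<close> runs
  through all nodes other than \<open>l\<close>.\<close>

lemma root_weight_pos:
  assumes mono: "strict_mono_on {1..N} g" and z: "z \<in> root_box N g" and l: "l \<in> {1..N}"
  shows "root_weight N g l z > 0"
proof -
  define s where "s j = (if j < l then j else j + 1)" for j
  have "bij_betw s {1..N - 1} ({1..N} - {l})"
    using l by (intro bij_betw_byWitness[where f' = "\<lambda>n. if n < l then n else n - 1"])
      (auto simp: s_def)
  then have "(\<Prod>n\<in>{1..N} - {l}. g l - g n) = (\<Prod>j\<in>{1..N - 1}. g l - g (s j))"
    by (rule prod.reindex_bij_betw[symmetric])
  then have "root_weight N g l z = (\<Prod>j\<in>{1..N - 1}. (g l - z j) / (g l - g (s j)))"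
    by (simp add: root_weight_def prod_dividef)
  moreover have "(g l - z j) / (g l - g (s j)) > 0" if j: "j \<in> {1..N - 1}" for j
  proof (cases "j < l")
    case True
    then show ?thesis
      using root_box_separates(1)[OF mono z j l] strict_mono_onD[OF mono, of j l] l j
      by (auto simp: s_def)
  next
    case False
    then show ?thesis
      using root_box_separates(2)[OF mono z j l] strict_mono_onD[OF mono, of l "j + 1"] l j
      by (auto simp: s_def intro!: divide_neg_neg)
  qed
  ultimately show ?thesis
    by (simp only: prod_pos)
qed

text \<open>The weight is affine in each single root; this form makes its partial derivative
  immediate.\<close>

lemma root_weight_update:
  assumes "k \<in> {1..N - 1}" "g l \<noteq> z k"
  shows "root_weight N g l (z(k := t)) = root_weight N g l z * (g l - t) / (g l - z k)"
proof -
  have "(\<Prod>j\<in>{1..N - 1} - {k}. g l - (z(k := t)) j) = (\<Prod>j\<in>{1..N - 1} - {k}. g l - z j)"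
    by (intro prod.cong) auto
  then show ?thesis
    using assms by (simp add: root_weight_def prod.remove[of _ k] del: fun_upd_apply)
      (simp add: field_simps)
qed

lemma sum_root_weight_quotient_zero:
  assumes mono: "strict_mono_on {1..N} g" and z: "z \<in> root_box N g" and k: "k \<in> {1..N - 1}"
  shows "(\<Sum>l\<in>{1..N}. root_weight N g l z / (g l - z k)) = 0"
proof -
  \<comment> \<open>The numerator of the weight with the factor for \<open>z k\<close> cancelled, as
    a polynomial in the node.\<close>
  define p where "p = (\<Prod>j\<in>{1..N - 1} - {k}. [:- z j, 1:])"
  have degp: "degree p = N - 2"
    using k by (simp add: p_def degree_prod_sum_eq)
  have N: "N \<ge> 2" using k by auto
  have "root_weight N g l z / (g l - z k) = poly p (g l) / (\<Prod>n\<in>{1..N} - {l}. g l - g n)"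
    if l: "l \<in> {1..N}" for l
    using root_box_separates(3)[OF mono z k l] k
    by (simp add: root_weight_def p_def poly_prod prod.remove[of _ k])
  then have "(\<Sum>l\<in>{1..N}. root_weight N g l z / (g l - z k))
      = (\<Sum>l\<in>{1..N}. poly p (g l) / (\<Prod>n\<in>{1..N} - {l}. g l - g n))"
    by (intro sum.cong) auto
  also have "\<dots> = coeff p (card {1..N} - 1)"
    using degp N strict_mono_on_imp_inj_on[OF mono]
    by (intro divided_difference_eq_coeff) auto
  also have "\<dots> = 0"
    using degp N by (intro coeff_eq_0) auto
  finally show ?thesis .
qed

section \<open>Derivatives of the weights, the entropy and its gradient\<close>

lemma root_weight_has_derivative:
  assumes "k \<in> {1..N - 1}" "g l \<noteq> z k"
  shows "((\<lambda>t. root_weight N g l (z(k := t))) has_real_derivative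
           - root_weight N g l z / (g l - z k)) (at (z k))"
  unfolding root_weight_update[of k N g l z, OF assms]
  using assms by (auto intro!: derivative_eq_intros)

text \<open>A closed form to differentiate a second time; it is shown to be the partial derivative
  of the entropy at points of the root box.\<close>

definition entropy_grad :: "nat \<Rightarrow> (nat \<Rightarrow> real) \<Rightarrow> nat \<Rightarrow> (nat \<Rightarrow> real) \<Rightarrow> real" where
  "entropy_grad N g k z =
     - (\<Sum>l\<in>{1..N}. root_weight N g l z / (g l - z k) * (ln (root_weight N g l z) + 1))"

lemma mixing_entropy_has_derivative:
  assumes mono: "strict_mono_on {1..N} g" and z: "z \<in> root_box N g" and k: "k \<in> {1..N - 1}"
  shows "((\<lambda>t. mixing_entropy N g (z(k := t))) has_real_derivative entropy_grad N g k z) (at (z k))"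
proof -
  have "((\<lambda>t. root_weight N g l (z(k := t)) * ln (root_weight N g l (z(k := t))))
      has_real_derivative - (root_weight N g l z / (g l - z k) * (ln (root_weight N g l z) + 1)))
      (at (z k))" if l: "l \<in> {1..N}" for l
    using root_weight_pos[OF mono z l] root_box_separates(3)[OF mono z k l]
    by (auto intro!: derivative_eq_intros root_weight_has_derivative[OF k])
      (simp add: divide_simps, simp add: algebra_simps)
  then show ?thesis
    unfolding mixing_entropy_def entropy_grad_def sum_negf[symmetric]
    by (intro DERIV_sum)
qed

lemma entropy_grad_has_derivative_diag:
  assumes mono: "strict_mono_on {1..N} g" and z: "z \<in> root_box N g" and k: "k \<in> {1..N - 1}"
  shows "((\<lambda>t. entropy_grad N g k (z(k := t))) has_real_derivative
           (\<Sum>l\<in>{1..N}. root_weight N g l z / (g l - z k)\<^sup>2)) (at (z k))"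
proof -
  \<comment> \<open>The denominator moves with \<open>t\<close> here: its variation cancels that of
    the weight, and only the derivative of \<open>ln\<close> survives.\<close>
  have "((\<lambda>t. - (root_weight N g l (z(k := t)) / (g l - t) * (ln (root_weight N g l (z(k := t))) + 1)))
      has_real_derivative root_weight N g l z / (g l - z k)\<^sup>2) (at (z k))" if l: "l \<in> {1..N}" for l
    using root_weight_pos[OF mono z l] root_box_separates(3)[OF mono z k l]
    by (auto intro!: derivative_eq_intros root_weight_has_derivative[OF k])
      (simp add: divide_simps power2_eq_square)
  then show ?thesis
    unfolding entropy_grad_def sum_negf[symmetric] fun_upd_same
    by (intro DERIV_sum)
qed

lemma entropy_grad_has_derivative_mixed:
  assumes mono: "strict_mono_on {1..N} g" and z: "z \<in> root_box N g"
    and j: "j \<in> {1..N - 1}" and k: "k \<in> {1..N - 1}" and jk: "j \<noteq> k"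
  shows "((\<lambda>t. entropy_grad N g k (z(j := t))) has_real_derivative
           (\<Sum>l\<in>{1..N}. root_weight N g l z / ((g l - z j) * (g l - z k))
              * (ln (root_weight N g l z) + 2))) (at (z j))"
proof -
  \<comment> \<open>Now the denominator is constant in \<open>t\<close>. The \<open>2\<close> is the
    old \<open>1\<close> plus another from differentiating \<open>ln\<close>.\<close>
  have "((\<lambda>t. - (root_weight N g l (z(j := t)) / (g l - z k) * (ln (root_weight N g l (z(j := t))) + 1)))
      has_real_derivative root_weight N g l z / ((g l - z j) * (g l - z k))
              * (ln (root_weight N g l z) + 2)) (at (z j))" if l: "l \<in> {1..N}" for l
    using root_weight_pos[OF mono z l] root_box_separates(3)[OF mono z k l]
      root_box_separates(3)[OF mono z j l]
    by (auto intro!: derivative_eq_intros root_weight_has_derivative[OF j])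
      (simp add: divide_simps, simp add: algebra_simps)
  then show ?thesis
    unfolding entropy_grad_def sum_negf[symmetric] fun_upd_other[OF jk[symmetric]]
    by (intro DERIV_sum)
qed

section \<open>Iterated partial derivatives of the entropy\<close>

lemma pderiv_at_mixing_entropy:
  assumes "strict_mono_on {1..N} g" "z \<in> root_box N g" "k \<in> {1..N - 1}"
  shows "pderiv_at k (mixing_entropy N g) z = entropy_grad N g k z"
  unfolding pderiv_at_def using mixing_entropy_has_derivative[OF assms] by (rule DERIV_imp_deriv)

text \<open>A derivative depends on values near the point, so equality with
  \<open>entropy_grad\<close> at \<open>z\<close> alone would not suffice. It holds for all small
  changes of one coordinate, since these stay in the root box.\<close>

lemma pderiv_at_mixing_entropy_has_derivative:
  assumes mono: "strict_mono_on {1..N} g" and z: "z \<in> root_box N g"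
    and j: "j \<in> {1..N - 1}" and k: "k \<in> {1..N - 1}"
    and D: "((\<lambda>t. entropy_grad N g k (z(j := t))) has_real_derivative D) (at (z j))"
  shows "((\<lambda>t. pderiv_at k (mixing_entropy N g) (z(j := t))) has_real_derivative D) (at (z j))"
proof -
  have "\<forall>\<^sub>F t in nhds (z j).
      pderiv_at k (mixing_entropy N g) (z(j := t)) = entropy_grad N g k (z(j := t))"
    using eventually_root_box_update[OF z j]
    by eventually_elim (rule pderiv_at_mixing_entropy[OF mono _ k])
  then show ?thesis
    using D by (subst DERIV_cong_ev[OF refl _ refl])
qed

lemma twice_pdifferentiable_mixing_entropy:
  assumes mono: "strict_mono_on {1..N} g"
  shows "twice_pdifferentiable_on {1..N - 1} (mixing_entropy N g) (root_box N g)"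
  unfolding twice_pdifferentiable_on_def pdifferentiable_at_def real_differentiable_def
proof (intro ballI conjI)
  fix z j k assume z: "z \<in> root_box N g" and k: "k \<in> {1..N - 1}"
  show "\<exists>D. ((\<lambda>t. mixing_entropy N g (z(k := t))) has_real_derivative D) (at (z k))"
    using mixing_entropy_has_derivative[OF mono z k] by blast
  assume j: "j \<in> {1..N - 1}"
  have "\<exists>D. ((\<lambda>t. entropy_grad N g k (z(j := t))) has_real_derivative D) (at (z j))"
    using entropy_grad_has_derivative_diag[OF mono z k]
      entropy_grad_has_derivative_mixed[OF mono z j k] by (cases "j = k") blast+
  then show "\<exists>D. ((\<lambda>t. pderiv_at k (mixing_entropy N g) (z(j := t))) has_real_derivative D) (at (z j))"
    using pderiv_at_mixing_entropy_has_derivative[OF mono z j k] by blast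
qed

lemma mixing_entropy_epd:
  assumes mono: "strict_mono_on {1..N} g" and z: "z \<in> root_box N g"
    and j: "j \<in> {1..N - 1}" and k: "k \<in> {1..N - 1}" and jk: "j \<noteq> k"
  shows "(z k - z j) * pderiv_at j (pderiv_at k (mixing_entropy N g)) z
           = pderiv_at j (mixing_entropy N g) z - pderiv_at k (mixing_entropy N g) z"
proof -
  let ?y = "\<lambda>l. root_weight N g l z"
  \<comment> \<open>Multiplying by \<open>z k - z j\<close> turns the product of reciprocals into
    \<open>1 / (g l - z k) - 1 / (g l - z j)\<close>. Splitting \<open>ln + 2\<close> as
    \<open>(ln + 1) + 1\<close> separates the gradient terms from the sums that vanish.\<close>
  have partial_fractions:
    "(z k - z j) * (?y l / ((g l - z j) * (g l - z k)) * (ln (?y l) + 2))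
       = (?y l / (g l - z k) * (ln (?y l) + 1) - ?y l / (g l - z j) * (ln (?y l) + 1))
         + (?y l / (g l - z k) - ?y l / (g l - z j))"
    if l: "l \<in> {1..N}" for l
  proof -
    have "g l - z j \<noteq> 0" "g l - z k \<noteq> 0"
      using root_box_separates(3)[OF mono z j l] root_box_separates(3)[OF mono z k l] by auto
    then show ?thesis
      by (simp add: divide_simps) (simp add: algebra_simps)
  qed
  have "(z k - z j) * pderiv_at j (pderiv_at k (mixing_entropy N g)) z
      = (\<Sum>l\<in>{1..N}. (z k - z j) * (?y l / ((g l - z j) * (g l - z k)) * (ln (?y l) + 2)))"
    unfolding pderiv_at_def[of j "pderiv_at k _"] sum_distrib_left[symmetric]
    using DERIV_imp_deriv[OF pderiv_at_mixing_entropy_has_derivative[OF mono z j k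
      entropy_grad_has_derivative_mixed[OF mono z j k jk]]] by simp
  also have "\<dots> = (\<Sum>l\<in>{1..N}.
      (?y l / (g l - z k) * (ln (?y l) + 1) - ?y l / (g l - z j) * (ln (?y l) + 1))
         + (?y l / (g l - z k) - ?y l / (g l - z j)))"
    by (intro sum.cong refl partial_fractions)
  \<comment> \<open>The minus sign in \<open>entropy_grad\<close> reverses the order of
    \<open>j\<close> and \<open>k\<close>.\<close>
  also have "\<dots> = entropy_grad N g j z - entropy_grad N g k z"
    unfolding sum.distrib sum_subtractf sum_root_weight_quotient_zero[OF mono z j]
      sum_root_weight_quotient_zero[OF mono z k] entropy_grad_def by simp
  finally show ?thesis
    by (simp only: pderiv_at_mixing_entropy[OF mono z j] pderiv_at_mixing_entropy[OF mono z k])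
qed

lemma pderiv_at_diag_mixing_entropy:
  assumes mono: "strict_mono_on {1..N} g" and z: "z \<in> root_box N g" and j: "j \<in> {1..N - 1}"
  shows "pderiv_at j (pderiv_at j (mixing_entropy N g)) z
           = (\<Sum>l\<in>{1..N}. root_weight N g l z / (g l - z j)\<^sup>2)"
  unfolding pderiv_at_def[of j "pderiv_at j _"]
  by (intro DERIV_imp_deriv pderiv_at_mixing_entropy_has_derivative[OF mono z j j]
      entropy_grad_has_derivative_diag[OF mono z j])

lemma sum_root_weight_quotient_square_pos:
  assumes mono: "strict_mono_on {1..N} g" and z: "z \<in> root_box N g" and j: "j \<in> {1..N - 1}"
  shows "(\<Sum>l\<in>{1..N}. root_weight N g l z / (g l - z j)\<^sup>2) > 0"
  using j root_weight_pos[OF mono z] root_box_separates(3)[OF mono z j]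
  by (intro sum_pos) auto

section \<open>Adding a constant\<close>

lemma has_real_derivative_add_const_iff:
  fixes f :: "real \<Rightarrow> real"
  shows "((\<lambda>t. f t + C) has_real_derivative D) (at x) \<longleftrightarrow> (f has_real_derivative D) (at x)"
proof
  assume "((\<lambda>t. f t + C) has_real_derivative D) (at x)"
  from DERIV_diff[OF this DERIV_const[of C]] show "(f has_real_derivative D) (at x)"
    by simp
next
  assume "(f has_real_derivative D) (at x)"
  from DERIV_add[OF this DERIV_const[of C]] show "((\<lambda>t. f t + C) has_real_derivative D) (at x)"
    by simp
qed

text \<open>Both sides choose from the same set of derivatives, so no differentiability is assumed.
  Equality as functions allows rewriting inside an outer \<open>pderiv_at\<close>.\<close>

lemma pderiv_at_add_const: "pderiv_at k (\<lambda>w. f w + C) = pderiv_at k f"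
  by (simp add: fun_eq_iff pderiv_at_def deriv_def has_real_derivative_add_const_iff)

lemma twice_pdifferentiable_on_add_const:
  "twice_pdifferentiable_on I (\<lambda>w. f w + C) S \<longleftrightarrow> twice_pdifferentiable_on I f S"
  by (simp add: twice_pdifferentiable_on_def pdifferentiable_at_def pderiv_at_add_const
      real_differentiable_def has_real_derivative_add_const_iff)

theorem corollary9p5:
  fixes N m :: nat and g :: "nat \<Rightarrow> real"
  assumes "N \<ge> 2" and "m = N - 1"
    and "0 < g 1" and "strict_mono_on {1..N} g"
  shows
    "(twice_pdifferentiable_on {1..m} (mixing_entropy N g) (root_box N g) \<and>
      (\<forall>z\<in>root_box N g.
        (\<forall>j\<in>{1..m}. \<forall>k\<in>{1..m}. j \<noteq> k \<longrightarrow>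
           (z k - z j) * pderiv_at j (pderiv_at k (mixing_entropy N g)) z
             = pderiv_at j (mixing_entropy N g) z - pderiv_at k (mixing_entropy N g) z) \<and>
        (\<forall>j\<in>{1..m}.
           pderiv_at j (pderiv_at j (mixing_entropy N g)) z
             = (\<Sum>l\<in>{1..N}. root_weight N g l z / (g l - z j)\<^sup>2) \<and>
           (\<Sum>l\<in>{1..N}. root_weight N g l z / (g l - z j)\<^sup>2) > 0))) \<and>
     (\<forall>C::real.
       twice_pdifferentiable_on {1..m} (\<lambda>w. mixing_entropy N g w + C) (root_box N g) \<and>
       (\<forall>z\<in>root_box N g.
        (\<forall>j\<in>{1..m}. \<forall>k\<in>{1..m}. j \<noteq> k \<longrightarrow>
           (z k - z j) * pderiv_at j (pderiv_at k (\<lambda>w. mixing_entropy N g w + C)) z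
             = pderiv_at j (\<lambda>w. mixing_entropy N g w + C) z
               - pderiv_at k (\<lambda>w. mixing_entropy N g w + C) z) \<and>
        (\<forall>j\<in>{1..m}.
           pderiv_at j (pderiv_at j (\<lambda>w. mixing_entropy N g w + C)) z
             = (\<Sum>l\<in>{1..N}. root_weight N g l z / (g l - z j)\<^sup>2) \<and>
           (\<Sum>l\<in>{1..N}. root_weight N g l z / (g l - z j)\<^sup>2) > 0)))"
  \<comment> \<open>With \<open>C\<close> removed, the second half repeats the first.\<close>
  unfolding pderiv_at_add_const twice_pdifferentiable_on_add_const \<open>m = N - 1\<close>
  using assms(4)
  by (auto simp: twice_pdifferentiable_mixing_entropy mixing_entropy_epd
      pderiv_at_diag_mixing_entropy sum_root_weight_quotient_square_pos
      simp del: One_nat_def)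

end
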